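(* Assume the following three conditions. (N$_0$) There exist $T_0\in(0,T)$ and subsets $\mathcal X_\ell\subset\hat{\mathcal X}$ ($\ell=1,\dots,\bar\ell$) with $\mathcal X_0\subset\bigcup_\ell\mathcal X_\ell$ and $\overline{\mathcal X}_\ell\subset\hat{\mathcal X}^o$ such that: (i) there exist $\xi_{\ell,k}\in\mathbb S$, $\varepsilon_{\ell,k}\in(0,1)$ and sets $\Theta_{\ell,k}\subset\Theta$ ($\ell=1,\dots,\bar\ell$, $k=1,\dots,\bar k_\ell$) with $\Theta=\bigcup_k\Theta_{\ell,k}$ for each $\ell$, together with bounded real functions $b_{j,\ell,k}(x_0,\theta)$ ($j=0,\dots,J-1$) on $\mathcal X_\ell\times\Theta_{\ell,k}$ and bounded real functions $b_{J,\ell,k}(x_0,x,\theta,v)$ of $x_0\in\mathcal X_\ell$, $x\in\tilde S_{x_0}(\xi_{\ell,k},\varepsilon_{\ell,k})$, $\theta\in\Theta_{\ell,k}$, $v\in\mathbb S$, such that for each $(\ell,k)$ $$|f(x,\theta)|\ge|G_{\ell,k}(x_0,x,\theta,x-x_0)|\quad\text{for all }x_0\in\mathcal X_\ell,\ x\in\tilde S_{x_0}(\xi_{\ell,k},\varepsilon_{\ell,k}),\ \theta\in\Theta_{\ell,k},$$ $$G_{\ell,k}(x_0,x,\theta,\xi)=\sum_{j=0}^{J-1}b_{j,\ell,k}(x_0,\theta)(\xi_{\ell,k}\cdot\xi)^j+b_{J,\ell,k}(x_0,x,\theta,|\xi|^{-1}\xi)(\xi_{\ell,k}\cdot\xi)^J,$$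 and $$\inf_{(x_0,\theta)\in\mathcal X_\ell\times\Theta_{\ell,k}}\max_{j=0,\dots,J-1}|b_{j,\ell,k}(x_0,\theta)|>0;$$ moreover $\bigcup_{\ell,k}\bigcup_{x_0\in\mathcal X_\ell}\overline{B(x_0,\varepsilon_{\ell,k})}\subset\hat{\mathcal X}$; (ii) there exist $c_0>0$ and, for each $(\ell,k)$, distinct positive numbers $\alpha_j=\alpha_j(\ell,k)$ ($j=0,\dots,J$) such that the sequence $$\Big(1-P\Big[\bigcup_{\ell}\bigcap_{k=1}^{\bar k_\ell}\bigcup_{s\in[0,T_0]}\bigcap_{j=0}^J\bigcup_{t\in[0,n^{-c_0}]}\big\{X_s\in\mathcal X_\ell,\ X_{s+t}-X_s\in\tilde S(\xi_{\ell,k},\varepsilon_{\ell,k}),\ |\xi_{\ell,k}\cdot(X_{s+t}-X_s)|=n^{-\alpha_j}\big\}\Big]\Big)_{n\in\mathbb N}$$ belongs to $\mathcal P$. (R) $\varrho\in(0,\infty)$ is a constant such that $\mathbb Q(x,\theta)|\theta-\theta^*|^{-2}\ge|f(x,\theta)|^\varrho$ for all $(x,\theta)\in\hat{\mathcal X}\times\Theta$ with $\theta\ne\theta^*$, and $f(\cdot,\theta)$ is Lipschitz continuous on $\hat{\mathcal X}$ uniformly in $\theta\in\Theta$. (C) There exists $\beta_0>0$ such that the sequence $$\Big(P\Big[\sup_{s,t\in[0,T]:\,X_s\in\hat{\mathcal X},\,t\in[s,s+n^{-1}]}|X_t-X_s|\ge n^{-\beta_0}\Big]\Big)_{n\in\mathbb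 N}$$ belongs to $\mathcal P$. Then for every $L>0$ there exists $c_L>0$ such that $P[\chi_0\le\rho^{-1}]\le c_L\rho^{-L}$ for all $\rho>0$.
   Context: Let $T>0$ and let $X=(X_t)_{t\in[0,T]}$ be a $\mathsf d$-dimensional separable stochastic process. $\Theta\subset\mathbb R^{\mathsf p}$ is a set, $\theta^*\in\Theta$, and $\mathcal X_0,\hat{\mathcal X}\subset\mathbb R^{\mathsf d}$ with $\mathcal X_0\subset\hat{\mathcal X}^o$, the interior of $\hat{\mathcal X}$. Let $\mathbb Q:\mathbb R^{\mathsf d}\times\Theta\to[0,\infty)$ and $f:\hat{\mathcal X}\times\Theta\to\mathbb R$ be functions, $J$ a fixed positive integer, and $$\chi_0=\inf_{\theta\in\Theta:\,\theta\ne\theta^*}\frac{\int_0^T\mathbb Q(X_t,\theta)\,dt}{|\theta-\theta^*|^2}.$$ All functions and events appearing are tacitly assumed measurable so that integrals and probabilities make sense. Notation: $\mathbb S=\{\eta\in\mathbb R^{\mathsf d}:|\eta|=1\}$; $B(x,\varepsilon)$ is the open ball. For $\xi\in\mathbb R^{\mathsf d}\setminus\{0\}$ and $a\in(0,1)$, $C(\xi,a)=\{\eta\in\mathbb R^{\mathsf d}:\eta\cdot\xi\ge(1-a)|\eta||\xi|\}$. $S(\xi,\varepsilon)=C(\xi,\varepsilon)\cap\{\eta:|\eta|\le\varepsilon\}$, $\tilde S(\xi,\varepsilon)=S(\xi,\varepsilon)\cup S(-\xi,\varepsilon)$, $\tilde S_{x_0}(\xi,\varepsilon)=x_0+\tilde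 S(\xi,\varepsilon)$. In $G_{\ell,k}$ the last term is read as $0$ when $\xi=0$. In the event in (N$_0$)(ii) only times with $s+t\le T$ are considered (this holds automatically for large $n$). $\mathcal P$ is the set of sequences $(\mathfrak a_n)_{n\in\mathbb N}$ of nonnegative numbers such that for every $L>0$ there is $C_L$ with $\mathfrak a_n\le C_L/n^L$ for all $n\in\mathbb N$. *)

theory Defs
  imports "HOL-Probability.Probability"
begin

text \<open>The class \<open>\<P>\<close> of sequences of nonnegative numbers indexed by the positive integers;
  the value at \<open>n = 0\<close> is irrelevant.\<close>

definition rapidly_decreasing :: "(nat \<Rightarrow> real) \<Rightarrow> bool" where
  "rapidly_decreasing a \<longleftrightarrow>
     (\<forall>n\<ge>1. 0 \<le> a n) \<and> (\<forall>L>0. \<exists>C. \<forall>n\<ge>1. a n \<le> C / real n powr L)"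

text \<open>Separability in the sense of Doob, with respect to closed sets.  (On a probability space the
  case \<open>F = {}\<close> forces \<open>D\<close> to be dense in \<open>[0,T]\<close>.)\<close>

definition separable_process ::
  "'w measure \<Rightarrow> real \<Rightarrow> (real \<Rightarrow> 'w \<Rightarrow> 'e::{second_countable_topology}) \<Rightarrow> bool" where
  "separable_process M T X \<longleftrightarrow>
     (\<forall>t\<in>{0..T}. X t \<in> borel_measurable M) \<and>
     (\<exists>D N. countable D \<and> D \<subseteq> {0..T} \<and> N \<in> null_sets M \<and>
        (\<forall>a b F. closed F \<longrightarrow>
           (\<forall>\<omega>\<in>space M - N.
              (\<forall>t\<in>D \<inter> {a<..<b}. X t \<omega> \<in> F) \<longrightarrow> (\<forall>t\<in>{0..T} \<inter> {a<..<b}. X t \<omega> \<in> F))))"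

definition cone :: "real^'d \<Rightarrow> real \<Rightarrow> (real^'d) set" where
  "cone \<xi> a = {\<eta>. \<eta> \<bullet> \<xi> \<ge> (1 - a) * norm \<eta> * norm \<xi>}"

definition sector :: "real^'d \<Rightarrow> real \<Rightarrow> (real^'d) set" where
  "sector \<xi> \<epsilon> = cone \<xi> \<epsilon> \<inter> {\<eta>. norm \<eta> \<le> \<epsilon>}"

definition dsector :: "real^'d \<Rightarrow> real \<Rightarrow> (real^'d) set" where
  "dsector \<xi> \<epsilon> = sector \<xi> \<epsilon> \<union> sector (- \<xi>) \<epsilon>"

definition dsector_at :: "real^'d \<Rightarrow> real^'d \<Rightarrow> real \<Rightarrow> (real^'d) set" where
  "dsector_at x0 \<xi> \<epsilon> = (\<lambda>\<eta>. x0 + \<eta>) ` dsector \<xi> \<epsilon>"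

text \<open>Extended-valued, so that the infimum is \<open>\<infinity>\<close> if \<open>\<Theta> = {\<theta>s}\<close>, and infinite integrals are
  allowed.\<close>

definition chi0 ::
  "real \<Rightarrow> (real \<Rightarrow> 'w \<Rightarrow> real^'d) \<Rightarrow> (real^'d \<Rightarrow> real^'p \<Rightarrow> real) \<Rightarrow>
   (real^'p) set \<Rightarrow> real^'p \<Rightarrow> 'w \<Rightarrow> ennreal" where
  "chi0 T X Q \<Theta> \<theta>s \<omega> =
     (INF \<theta>\<in>\<Theta> - {\<theta>s}.
        (\<integral>\<^sup>+t\<in>{0..T}. ennreal (Q (X t \<omega>) \<theta>) \<partial>lebesgue) / ennreal ((norm (\<theta> - \<theta>s))\<^sup>2))"

text \<open>Here \<open>e\<close> is the direction \<open>\<xi>\<^bsub>l,k\<^esub>\<close>, and \<open>b\<close>, \<open>bJ\<close> are the coefficients for that \<open>(l,k)\<close>.\<close>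

definition G_expansion ::
  "nat \<Rightarrow> real^'d \<Rightarrow> (nat \<Rightarrow> real^'d \<Rightarrow> real^'p \<Rightarrow> real) \<Rightarrow>
   (real^'d \<Rightarrow> real^'d \<Rightarrow> real^'p \<Rightarrow> real^'d \<Rightarrow> real) \<Rightarrow>
   real^'d \<Rightarrow> real^'d \<Rightarrow> real^'p \<Rightarrow> real^'d \<Rightarrow> real" where
  "G_expansion J e b bJ x0 x \<theta> \<xi> =
     (\<Sum>j<J. b j x0 \<theta> * (e \<bullet> \<xi>) ^ j) +
     (if \<xi> = 0 then 0 else bJ x0 x \<theta> ((1 / norm \<xi>) *\<^sub>R \<xi>) * (e \<bullet> \<xi>) ^ J)"

text \<open>The requirements on a single pair \<open>(l,k)\<close>: \<open>Xl\<close>, \<open>e\<close>, \<open>\<epsilon>\<close>, \<open>\<Theta>lk\<close> stand for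
  \<open>\<X>\<^sub>l\<close>, \<open>\<xi>\<^bsub>l,k\<^esub>\<close>, \<open>\<epsilon>\<^bsub>l,k\<^esub>\<close>, \<open>\<Theta>\<^bsub>l,k\<^esub>\<close>.  The infimum is taken in the extended reals, so it is
  \<open>\<infinity>\<close> over an empty set.\<close>

definition expansion_bound ::
  "(real^'d \<Rightarrow> real^'p \<Rightarrow> real) \<Rightarrow> nat \<Rightarrow> (real^'d) set \<Rightarrow> real^'d \<Rightarrow> real \<Rightarrow> (real^'p) set \<Rightarrow>
   (nat \<Rightarrow> real^'d \<Rightarrow> real^'p \<Rightarrow> real) \<Rightarrow>
   (real^'d \<Rightarrow> real^'d \<Rightarrow> real^'p \<Rightarrow> real^'d \<Rightarrow> real) \<Rightarrow> bool" where
  "expansion_bound f J Xl e \<epsilon> \<Theta>lk b bJ \<longleftrightarrow>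
     (\<forall>j<J. \<exists>B. \<forall>x0\<in>Xl. \<forall>\<theta>\<in>\<Theta>lk. \<bar>b j x0 \<theta>\<bar> \<le> B) \<and>
     (\<exists>B. \<forall>x0\<in>Xl. \<forall>x\<in>dsector_at x0 e \<epsilon>. \<forall>\<theta>\<in>\<Theta>lk. \<forall>v\<in>sphere 0 1. \<bar>bJ x0 x \<theta> v\<bar> \<le> B) \<and>
     (\<forall>x0\<in>Xl. \<forall>x\<in>dsector_at x0 e \<epsilon>. \<forall>\<theta>\<in>\<Theta>lk.
        \<bar>f x \<theta>\<bar> \<ge> \<bar>G_expansion J e b bJ x0 x \<theta> (x - x0)\<bar>) \<and>
     (INF (x0, \<theta>)\<in>Xl \<times> \<Theta>lk. ereal (Max ((\<lambda>j. \<bar>b j x0 \<theta>\<bar>) ` {..<J}))) > 0"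

definition hitting_event ::
  "'w measure \<Rightarrow> real \<Rightarrow> (real \<Rightarrow> 'w \<Rightarrow> real^'d) \<Rightarrow> nat \<Rightarrow> real \<Rightarrow> nat \<Rightarrow> (nat \<Rightarrow> nat) \<Rightarrow>
   (nat \<Rightarrow> (real^'d) set) \<Rightarrow> (nat \<Rightarrow> nat \<Rightarrow> real^'d) \<Rightarrow> (nat \<Rightarrow> nat \<Rightarrow> real) \<Rightarrow>
   real \<Rightarrow> (nat \<Rightarrow> nat \<Rightarrow> nat \<Rightarrow> real) \<Rightarrow> nat \<Rightarrow> 'w set" where
  "hitting_event M T X J T0 lbar kbar \<X> \<xi> \<epsilon> c0 \<alpha> n =
     {\<omega>\<in>space M.
        \<exists>l\<in>{1..lbar}. \<forall>k\<in>{1..kbar l}. \<exists>s\<in>{0..T0}. \<forall>j\<in>{0..J}. \<exists>t\<in>{0..real n powr (- c0)}.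
          s + t \<le> T \<and>
          X s \<omega> \<in> \<X> l \<and>
          X (s + t) \<omega> - X s \<omega> \<in> dsector (\<xi> l k) (\<epsilon> l k) \<and>
          \<bar>\<xi> l k \<bullet> (X (s + t) \<omega> - X s \<omega>)\<bar> = real n powr (- \<alpha> l k j)}"

text \<open>The standing assumption that the events considered are measurable is part
  of the condition (and likewise in \<open>condition_C\<close> below), since these events depend on the existentially quantified data.\<close>

definition condition_N0 ::
  "'w measure \<Rightarrow> real \<Rightarrow> (real \<Rightarrow> 'w \<Rightarrow> real^'d) \<Rightarrow> (real^'p) set \<Rightarrow> (real^'d) set \<Rightarrow>
   (real^'d) set \<Rightarrow> (real^'d \<Rightarrow> real^'p \<Rightarrow> real) \<Rightarrow> nat \<Rightarrow> bool" where
  "condition_N0 M T X \<Theta> X0 Xhat f J \<longleftrightarrow>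
     (\<exists>T0 lbar \<X>.
        0 < T0 \<and> T0 < T \<and>
        (\<forall>l\<in>{1..lbar}. \<X> l \<subseteq> Xhat \<and> closure (\<X> l) \<subseteq> interior Xhat) \<and>
        X0 \<subseteq> (\<Union>l\<in>{1..lbar}. \<X> l) \<and>
        (\<exists>kbar \<xi> \<epsilon> \<Theta>s.
           (\<forall>l\<in>{1..lbar}. \<forall>k\<in>{1..kbar l}.
              norm (\<xi> l k) = 1 \<and> 0 < \<epsilon> l k \<and> \<epsilon> l k < 1 \<and> \<Theta>s l k \<subseteq> \<Theta>) \<and>
           (\<forall>l\<in>{1..lbar}. \<Theta> = (\<Union>k\<in>{1..kbar l}. \<Theta>s l k)) \<and>
           (\<exists>b bJ. \<forall>l\<in>{1..lbar}. \<forall>k\<in>{1..kbar l}.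
              expansion_bound f J (\<X> l) (\<xi> l k) (\<epsilon> l k) (\<Theta>s l k) (b l k) (bJ l k)) \<and>
           (\<Union>l\<in>{1..lbar}. \<Union>k\<in>{1..kbar l}. \<Union>x0\<in>\<X> l. closure (ball x0 (\<epsilon> l k))) \<subseteq> Xhat \<and>
           (\<exists>c0 \<alpha>. c0 > 0 \<and>
              (\<forall>l\<in>{1..lbar}. \<forall>k\<in>{1..kbar l}.
                 inj_on (\<alpha> l k) {0..J} \<and> (\<forall>j\<in>{0..J}. \<alpha> l k j > 0)) \<and>
              (\<forall>n\<ge>1. hitting_event M T X J T0 lbar kbar \<X> \<xi> \<epsilon> c0 \<alpha> n \<in> sets M) \<and>
              rapidly_decreasing
                (\<lambda>n. 1 - measure M (hitting_event M T X J T0 lbar kbar \<X> \<xi> \<epsilon> c0 \<alpha> n)))))"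

definition condition_R ::
  "(real^'p) set \<Rightarrow> real^'p \<Rightarrow> (real^'d) set \<Rightarrow> (real^'d \<Rightarrow> real^'p \<Rightarrow> real) \<Rightarrow>
   (real^'d \<Rightarrow> real^'p \<Rightarrow> real) \<Rightarrow> real \<Rightarrow> bool" where
  "condition_R \<Theta> \<theta>s Xhat Q f \<rho> \<longleftrightarrow>
     0 < \<rho> \<and>
     (\<forall>x\<in>Xhat. \<forall>\<theta>\<in>\<Theta>. \<theta> \<noteq> \<theta>s \<longrightarrow> Q x \<theta> / (norm (\<theta> - \<theta>s))\<^sup>2 \<ge> \<bar>f x \<theta>\<bar> powr \<rho>) \<and>
     (\<exists>K. \<forall>\<theta>\<in>\<Theta>. K-lipschitz_on Xhat (\<lambda>x. f x \<theta>))"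

text \<open>In \<open>ennreal\<close>, the supremum over the empty set (no \<open>s\<close> with \<open>X\<^sub>s\<close> in \<open>Xhat\<close>) is \<open>0\<close>.\<close>

definition oscillation_event ::
  "'w measure \<Rightarrow> real \<Rightarrow> (real \<Rightarrow> 'w \<Rightarrow> real^'d) \<Rightarrow> (real^'d) set \<Rightarrow> real \<Rightarrow> nat \<Rightarrow> 'w set" where
  "oscillation_event M T X Xhat \<beta>0 n =
     {\<omega>\<in>space M.
        (SUP (s, t)\<in>{(s, t). s \<in> {0..T} \<and> t \<in> {0..T} \<and> X s \<omega> \<in> Xhat \<and> t \<in> {s..s + 1 / real n}}.
           ennreal (norm (X t \<omega> - X s \<omega>))) \<ge> ennreal (real n powr (- \<beta>0))}"

definition condition_C ::
  "'w measure \<Rightarrow> real \<Rightarrow> (real \<Rightarrow> 'w \<Rightarrow> real^'d) \<Rightarrow> (real^'d) set \<Rightarrow> bool" where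
  "condition_C M T X Xhat \<longleftrightarrow>
     (\<exists>\<beta>0>0.
        (\<forall>n\<ge>1. oscillation_event M T X Xhat \<beta>0 n \<in> sets M) \<and>
        rapidly_decreasing (\<lambda>n. measure M (oscillation_event M T X Xhat \<beta>0 n)))"

end

theory Submission
  imports Defs "HOL-Computational_Algebra.Polynomial"
begin

text \<open>
  The statistic \<open>chi0\<close> can only be small if, for some \<open>\<theta>\<close>, the function \<open>f (\<cdot>, \<theta>)\<close> is small along almost
  all of the path.  A path that leaves a point \<open>x0\<close> and passes through points
  at distances of \<open>J\<close> different orders of magnitude from it, measured in the direction \<open>\<xi>\<close>,
  excludes this.  Let \<open>u\<^sub>j = \<plusminus>n\<^sup>-\<^sup>\<alpha>\<close> with \<open>\<alpha> = \<alpha>\<^sub>j\<close> be these distances.  If \<open>f\<close> were at most \<open>\<eta>\<close> at all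
  \<open>J\<close> points, the polynomial part of the expansion \<open>G\<close> at \<open>x0\<close>, of degree less than \<open>J\<close>, would be
  bounded by \<open>\<eta> + B \<bar>u\<^sub>j\<bar>\<^sup>J\<close> at \<open>u\<^sub>j\<close>.  Lagrange interpolation recovers its coefficients from these
  values.  Since points of different orders of magnitude satisfy \<open>\<bar>u\<^sub>j - u\<^sub>i\<bar> \<ge> \<bar>u\<^sub>j\<bar> / 2\<close>, each denominator
  costs at most a constant times \<open>\<bar>u\<^sub>j\<bar>\<close> to the power \<open>-(J - 1)\<close>, so that the remainder contributes
  only \<open>O(\<bar>u\<^sub>j\<bar>)\<close>, which tends to \<open>0\<close>.  One coefficient is bounded away from \<open>0\<close>, hence
  \<open>\<eta>\<close> is at least some negative power of \<open>n\<close>, uniformly in \<open>x0\<close> and \<open>\<theta>\<close>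
  (\<open>coeff_le_values_at_separated_points\<close>, \<open>expansion_bound_lower\<close>).

  So on the hitting event, for every \<open>\<theta>\<close> there is a time \<open>r\<close> with \<open>\<bar>f (X\<^sub>r, \<theta>)\<bar> \<ge> n\<^sup>-\<^sup>\<kappa>\<close>.  If moreover the path
  does not oscillate much on the time scale \<open>n\<^sup>-\<^sup>N\<close> with \<open>N\<close> large, the Lipschitz continuity of \<open>f\<close> keeps
  \<open>\<bar>f (X\<^sub>t, \<theta>)\<bar>\<close> above a slightly smaller power of \<open>n\<close> during the time \<open>n\<^sup>-\<^sup>N\<close>, and integrating \<open>Q\<close> over this
  interval gives \<open>chi0 > n\<^sup>-\<^sup>\<gamma>\<close> (\<open>lower_bound_persists_near_start\<close>, \<open>chi0_ge\<close>).  The exceptional events have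
  rapidly decreasing probability in \<open>n\<close>; as \<open>n\<^sup>\<gamma>\<close> runs through a geometrically dense set of thresholds,
  this becomes a bound by every power of \<open>\<rho>\<close> (\<open>polynomial_tail_of_rapidly_decreasing\<close>).
\<close>

section \<open>Coefficients of a polynomial and its values at separated points\<close>

lemma lagrange_interpolation:
  fixes p :: "'a::field poly" and u :: "'i \<Rightarrow> 'a"
  assumes fin: "finite S" and inj: "inj_on u S" and deg: "degree p < card S"
  shows "p = (\<Sum>j\<in>S. smult (poly p (u j) / (\<Prod>i\<in>S - {j}. u j - u i))
                            (\<Prod>i\<in>S - {j}. [:- u i, 1:]))" (is "p = ?q")
proof (rule poly_eqI_degree[where A = "u ` S"])
  have card: "card (u ` S) = card S" using inj by (rule card_image)
  show "card (u ` S) > degree p" using deg card by simp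
  have "degree (\<Prod>i\<in>S - {j}. [:- u i, 1:]) \<le> card S - 1" if "j \<in> S" for j
  proof -
    have "degree (\<Prod>i\<in>S - {j}. [:- u i, 1:]) \<le> (\<Sum>i\<in>S - {j}. degree [:- u i, 1:])"
      using degree_prod_sum_le[of "S - {j}" "\<lambda>i. [:- u i, 1:]"] fin by (simp add: o_def)
    also have "\<dots> = card (S - {j})" by simp
    finally show ?thesis using that fin by simp
  qed
  then have "degree ?q \<le> card S - 1"
    using fin by (intro degree_sum_le) (auto intro: order_trans[OF degree_smult_le])
  then show "card (u ` S) > degree ?q" using card deg by linarith
next
  fix x assume "x \<in> u ` S"
  then obtain m where m: "m \<in> S" "x = u m" by auto
  have nz: "(\<Prod>i\<in>S - {m}. u m - u i) \<noteq> 0"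
    using fin inj m by (auto simp: inj_on_def)
  have "poly ?q x = (\<Sum>j\<in>S. poly p (u j) / (\<Prod>i\<in>S - {j}. u j - u i) * (\<Prod>i\<in>S - {j}. u m - u i))"
    using m by (simp add: poly_sum poly_prod)
  also have "\<dots> = (\<Sum>j\<in>S. if j = m then poly p (u m) else 0)"
  proof (rule sum.cong[OF refl])
    fix j assume j: "j \<in> S"
    show "poly p (u j) / (\<Prod>i\<in>S - {j}. u j - u i) * (\<Prod>i\<in>S - {j}. u m - u i)
        = (if j = m then poly p (u m) else 0)"
    proof (cases "j = m")
      case True then show ?thesis using nz by simp
    next
      case False
      then have "(\<Prod>i\<in>S - {j}. u m - u i) = 0" using fin m by (intro prod_zero) auto
      then show ?thesis using False by simp
    qed
  qed
  also have "\<dots> = poly p x" using m fin by simp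
  finally show "poly p x = poly ?q x" by simp
qed

text \<open>Multiplication by a monic linear factor with root in \<open>[-1, 1]\<close> at most doubles the largest
  coefficient.\<close>

lemma coeff_prod_linear_le:
  fixes u :: "'i \<Rightarrow> real"
  assumes "finite S" and "\<And>i. i \<in> S \<Longrightarrow> \<bar>u i\<bar> \<le> 1"
  shows "\<bar>coeff (\<Prod>i\<in>S. [:- u i, 1:]) m\<bar> \<le> 2 ^ card S"
  using assms
proof (induction S arbitrary: m rule: finite_induct)
  case empty
  then show ?case by (simp add: one_pCons coeff_pCons split: nat.split)
next
  case (insert a S)
  let ?q = "\<Prod>i\<in>S. [:- u i, 1:]"
  have IH: "\<bar>coeff ?q m\<bar> \<le> 2 ^ card S" for m using insert by auto
  have "\<bar>u a * coeff ?q m\<bar> \<le> 1 * 2 ^ card S"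
    unfolding abs_mult using insert.prems IH by (intro mult_mono) auto
  moreover have "\<bar>coeff (pCons 0 ?q) m\<bar> \<le> 2 ^ card S"
    using IH by (cases m) auto
  moreover have "coeff (\<Prod>i\<in>insert a S. [:- u i, 1:]) m = - (u a * coeff ?q m) + coeff (pCons 0 ?q) m"
    using insert.hyps by simp
  ultimately have "\<bar>coeff (\<Prod>i\<in>insert a S. [:- u i, 1:]) m\<bar> \<le> 2 ^ card S + 2 ^ card S" by linarith
  then show ?case using insert.hyps by simp
qed

text \<open>In the Lagrange formula the numerators have coefficients at most \<open>2\<^bsup>J - 1\<^esup>\<close>, and separation bounds
  each denominator below by \<open>(\<bar>u j\<bar> / 2)\<^bsup>J - 1\<^esup>\<close>.  That the separation is relative to \<open>\<bar>u j\<bar>\<close> is what makes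
  values of size \<open>h j = O(\<bar>u j\<bar>\<^sup>J)\<close> contribute only \<open>O(\<bar>u j\<bar>)\<close>, whatever the other points are.\<close>

lemma coeff_le_values_at_separated_points:
  fixes b u h :: "nat \<Rightarrow> real"
  assumes u: "\<And>j. j < J \<Longrightarrow> u j \<noteq> 0 \<and> \<bar>u j\<bar> \<le> 1"
    and sep: "\<And>i j. i < J \<Longrightarrow> j < J \<Longrightarrow> i \<noteq> j \<Longrightarrow> \<bar>u j\<bar> / 2 \<le> \<bar>u j - u i\<bar>"
    and h: "\<And>j. j < J \<Longrightarrow> \<bar>\<Sum>i<J. b i * u j ^ i\<bar> \<le> h j"
    and m: "m < J"
  shows "\<bar>b m\<bar> \<le> (\<Sum>j<J. 4 ^ (J - 1) * (h j / \<bar>u j\<bar> ^ (J - 1)))"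
proof -
  define p where "p = (\<Sum>i<J. monom (b i) i)"
  have p_coeff: "coeff p m = b m" using m by (simp add: p_def coeff_sum coeff_monom)
  have p_poly: "poly p x = (\<Sum>i<J. b i * x ^ i)" for x by (simp add: p_def poly_sum poly_monom)
  have "degree p \<le> J - 1"
    unfolding p_def by (intro degree_sum_le) (auto intro: order_trans[OF degree_monom_le])
  then have deg: "degree p < card {..<J}" using m by simp
  have inj: "inj_on u {..<J}"
  proof (rule inj_onI, rule ccontr)
    fix i j assume "i \<in> {..<J}" "j \<in> {..<J}" "u i = u j" "i \<noteq> j"
    then show False using sep[of i j] u[of j] by simp
  qed
  let ?D = "\<lambda>j. \<Prod>i\<in>{..<J} - {j}. u j - u i"
  let ?R = "\<lambda>j. \<Prod>i\<in>{..<J} - {j}. [:- u i, 1:]"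
  have "b m = (\<Sum>j<J. poly p (u j) / ?D j * coeff (?R j) m)"
    unfolding p_coeff[symmetric]
    by (subst lagrange_interpolation[OF _ inj deg]) (simp_all add: coeff_sum)
  then have "\<bar>b m\<bar> \<le> (\<Sum>j<J. \<bar>poly p (u j) / ?D j * coeff (?R j) m\<bar>)"
    by (simp only: sum_abs)
  also have "\<dots> \<le> (\<Sum>j<J. 4 ^ (J - 1) * (h j / \<bar>u j\<bar> ^ (J - 1)))"
  proof (rule sum_mono)
    fix j assume "j \<in> {..<J}"
    then have j: "j < J" by simp
    have card: "card ({..<J} - {j}) = J - 1" using j by simp
    have upos: "\<bar>u j\<bar> > 0" using u[OF j] by simp
    have "(\<bar>u j\<bar> / 2) ^ (J - 1) = (\<Prod>i\<in>{..<J} - {j}. \<bar>u j\<bar> / 2)" using card by simp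
    also have "\<dots> \<le> (\<Prod>i\<in>{..<J} - {j}. \<bar>u j - u i\<bar>)"
      using sep j by (intro prod_mono) auto
    finally have D: "(\<bar>u j\<bar> / 2) ^ (J - 1) \<le> \<bar>?D j\<bar>" by (simp add: abs_prod)
    have P: "\<bar>poly p (u j)\<bar> \<le> h j" using h[OF j] by (simp add: p_poly)
    have R: "\<bar>coeff (?R j) m\<bar> \<le> 2 ^ (J - 1)"
      using coeff_prod_linear_le[of "{..<J} - {j}" u m] u card by auto
    have "\<bar>poly p (u j) / ?D j * coeff (?R j) m\<bar> = \<bar>poly p (u j)\<bar> / \<bar>?D j\<bar> * \<bar>coeff (?R j) m\<bar>"
      by (simp add: abs_mult)
    also have "\<dots> \<le> (h j / (\<bar>u j\<bar> / 2) ^ (J - 1)) * 2 ^ (J - 1)"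
      using P R D upos by (intro mult_mono frac_le) auto
    also have "\<dots> = 4 ^ (J - 1) * (h j / \<bar>u j\<bar> ^ (J - 1))"
    proof -
      have "(4::real) ^ (J - 1) = 2 ^ (J - 1) * 2 ^ (J - 1)" by (simp flip: power_mult_distrib)
      then show ?thesis by (simp add: power_divide)
    qed
    finally show "\<bar>poly p (u j) / ?D j * coeff (?R j) m\<bar> \<le> 4 ^ (J - 1) * (h j / \<bar>u j\<bar> ^ (J - 1))" .
  qed
  finally show ?thesis .
qed

section \<open>Comparison of negative powers of \<open>n\<close>\<close>

lemma eventually_mult_powr_le:
  fixes a b C :: real
  assumes "a < b"
  shows "\<forall>\<^sub>F n in sequentially. C * real n powr (- b) \<le> real n powr (- a)"
proof -
  have "(\<lambda>n. C * real n powr (- (b - a))) \<longlonglongrightarrow> C * 0"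
    using assms by (intro tendsto_mult tendsto_const tendsto_neg_powr filterlim_real_sequentially) auto
  then have "\<forall>\<^sub>F n in sequentially. C * real n powr (- (b - a)) < 1"
    by (auto elim: order_tendstoD)
  then show ?thesis using eventually_gt_at_top[of 0]
  proof eventually_elim
    case (elim n)
    have "C * real n powr (- b) = C * real n powr (- (b - a)) * real n powr (- a)"
      by (simp add: powr_add[symmetric])
    also have "\<dots> \<le> 1 * real n powr (- a)"
      using elim by (intro mult_right_mono) auto
    finally show ?case by simp
  qed
qed

lemma eventually_mult_powr_le_const:
  fixes b C \<delta> :: real
  assumes "0 < b" "0 < \<delta>"
  shows "\<forall>\<^sub>F n in sequentially. C * real n powr (- b) \<le> \<delta>"
  using eventually_mult_powr_le[OF assms(1), of "C / \<delta>"] eventually_gt_at_top[of 0]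
proof eventually_elim
  case (elim n)
  then show ?case using assms by (simp add: field_simps)
qed

text \<open>Finitely many bounds by unspecified negative powers of \<open>n\<close> can be given the same exponent; it is
  applied to the finitely many pairs \<open>(l, k)\<close> of the covering.\<close>

lemma common_exponent:
  assumes fin: "finite I"
    and ex: "\<And>i. i \<in> I \<Longrightarrow> \<exists>\<kappa>>0. \<forall>\<^sub>F n in sequentially. P i n (real n powr (- \<kappa>))"
    and anti: "\<And>i n x y. i \<in> I \<Longrightarrow> P i n x \<Longrightarrow> y \<le> x \<Longrightarrow> P i n y"
  shows "\<exists>\<kappa>>0. \<forall>\<^sub>F n in sequentially. \<forall>i\<in>I. P i n (real n powr (- \<kappa>))"
proof -
  have "\<forall>i\<in>I. \<exists>\<kappa>. \<kappa> > 0 \<and> (\<forall>\<^sub>F n in sequentially. P i n (real n powr (- \<kappa>)))"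
    using ex by blast
  from bchoice[OF this] obtain k where k: "\<And>i. i \<in> I \<Longrightarrow> k i > 0"
      "\<And>i. i \<in> I \<Longrightarrow> \<forall>\<^sub>F n in sequentially. P i n (real n powr (- k i))"
    by blast
  define \<kappa> where "\<kappa> = 1 + sum k I"
  have le: "k i \<le> \<kappa>" if "i \<in> I" for i
  proof -
    have "k i \<le> sum k I" by (rule member_le_sum) (use that fin k(1) in \<open>auto intro: less_imp_le\<close>)
    then show ?thesis by (simp add: \<kappa>_def)
  qed
  have "\<forall>\<^sub>F n in sequentially. \<forall>i\<in>I. P i n (real n powr (- k i))"
    using fin k(2) by (intro eventually_ball_finite) auto
  then have "\<forall>\<^sub>F n in sequentially. \<forall>i\<in>I. P i n (real n powr (- \<kappa>))"
    using eventually_gt_at_top[of 0]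
  proof eventually_elim
    case (elim n)
    show ?case
    proof
      fix i assume i: "i \<in> I"
      have "real n powr (- \<kappa>) \<le> real n powr (- k i)"
        using le[OF i] elim(2) by (intro powr_mono) auto
      then show "P i n (real n powr (- \<kappa>))" using anti i elim(1) by blast
    qed
  qed
  moreover have "\<kappa> > 0" unfolding \<kappa>_def using k(1) by (intro add_pos_nonneg sum_nonneg) (auto intro: less_imp_le)
  ultimately show ?thesis by blast
qed

section \<open>A lower bound for \<open>f\<close> at one of the hitting points\<close>

text \<open>For \<open>\<epsilon> < 1\<close>, displacements in the double sector are comparable to their components along the axis, so hitting
  \<open>\<bar>e \<bullet> \<eta>\<bar> = n\<^sup>-\<^sup>\<alpha>\<close> also means that the path is still close to its starting point.\<close>

lemma norm_le_inner_of_dsector: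
  assumes "\<eta> \<in> dsector e \<epsilon>" and "norm e = 1"
  shows "(1 - \<epsilon>) * norm \<eta> \<le> \<bar>e \<bullet> \<eta>\<bar>"
  using assms by (auto simp: dsector_def sector_def cone_def inner_commute)

lemma separated_of_distinct_scales:
  fixes \<alpha> :: "nat \<Rightarrow> real"
  assumes inj: "inj_on \<alpha> {..<J}"
  shows "\<forall>\<^sub>F n in sequentially. \<forall>i<J. \<forall>j<J. i \<noteq> j \<longrightarrow>
           (\<forall>v w. \<bar>v\<bar> = real n powr (- \<alpha> i) \<longrightarrow> \<bar>w\<bar> = real n powr (- \<alpha> j) \<longrightarrow> \<bar>w\<bar> / 2 \<le> \<bar>w - v\<bar>)"
proof -
  have "\<forall>\<^sub>F n in sequentially. \<forall>i\<in>{..<J}. \<forall>j\<in>{..<J}. \<alpha> i < \<alpha> j \<longrightarrow>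
          2 * real n powr (- \<alpha> j) \<le> real n powr (- \<alpha> i)"
    by (intro eventually_ball_finite ballI) (auto intro: eventually_mult_powr_le)
  then show ?thesis
  proof eventually_elim
    case (elim n)
    show ?case
    proof (intro allI impI)
      fix i j :: nat and v w :: real
      assume *: "i < J" "j < J" "i \<noteq> j" "\<bar>v\<bar> = real n powr (- \<alpha> i)" "\<bar>w\<bar> = real n powr (- \<alpha> j)"
      then have "\<alpha> i \<noteq> \<alpha> j" using inj by (auto simp: inj_on_def)
      then consider "\<alpha> i < \<alpha> j" | "\<alpha> j < \<alpha> i" by linarith
      then show "\<bar>w\<bar> / 2 \<le> \<bar>w - v\<bar>"
      proof cases
        case 1
        then have "2 * \<bar>w\<bar> \<le> \<bar>v\<bar>" using elim * by auto
        then show ?thesis by linarith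
      next
        case 2
        then have "2 * \<bar>v\<bar> \<le> \<bar>w\<bar>" using elim * by auto
        then show ?thesis by linarith
      qed
    qed
  qed
qed

text \<open>Otherwise \<open>f\<close> is below \<open>n\<^sup>-\<^sup>\<kappa>\<close> at all \<open>J\<close> points, and \<open>coeff_le_values_at_separated_points\<close>, applied with
  \<open>h j = n\<^sup>-\<^sup>\<kappa> + B' \<bar>u j\<bar>\<^sup>J\<close>, makes every coefficient at most \<open>\<delta> / 2\<close> for large \<open>n\<close>, while the
  nondegeneracy of the expansion provides one larger than \<open>\<delta>\<close>.  The exponent \<open>\<kappa>\<close> and the threshold for \<open>n\<close>
  depend on neither \<open>x0\<close> nor \<open>\<theta>\<close>, which later allows taking the infimum over \<open>\<theta>\<close>.\<close>

lemma expansion_bound_lower: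
  fixes f :: "real^'d \<Rightarrow> real^'p \<Rightarrow> real"
  assumes exp: "expansion_bound f J Xl e \<epsilon> \<Theta>lk b bJ"
    and J: "1 \<le> J"
    and inj: "inj_on \<alpha> {..<J}" and pos: "\<And>j. j < J \<Longrightarrow> \<alpha> j > 0"
  shows "\<exists>\<kappa>>0. \<forall>\<^sub>F n in sequentially. \<forall>x0\<in>Xl. \<forall>\<theta>\<in>\<Theta>lk. \<forall>x.
           (\<forall>j<J. x j - x0 \<in> dsector e \<epsilon> \<and> \<bar>e \<bullet> (x j - x0)\<bar> = real n powr (- \<alpha> j)) \<longrightarrow>
           (\<exists>j<J. real n powr (- \<kappa>) \<le> \<bar>f (x j) \<theta>\<bar>)"
proof -
  have "\<exists>B. \<forall>x0\<in>Xl. \<forall>x\<in>dsector_at x0 e \<epsilon>. \<forall>\<theta>\<in>\<Theta>lk. \<forall>v\<in>sphere 0 1. \<bar>bJ x0 x \<theta> v\<bar> \<le> B"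
    using exp unfolding expansion_bound_def by (elim conjE)
  then obtain B where B: "\<And>x0 x \<theta> v. x0 \<in> Xl \<Longrightarrow> x \<in> dsector_at x0 e \<epsilon> \<Longrightarrow> \<theta> \<in> \<Theta>lk \<Longrightarrow> v \<in> sphere 0 1 \<Longrightarrow>
      \<bar>bJ x0 x \<theta> v\<bar> \<le> B"
    by blast
  have fG: "\<bar>G_expansion J e b bJ x0 x \<theta> (x - x0)\<bar> \<le> \<bar>f x \<theta>\<bar>"
    if "x0 \<in> Xl" "x \<in> dsector_at x0 e \<epsilon>" "\<theta> \<in> \<Theta>lk" for x0 x \<theta>
    using exp that unfolding expansion_bound_def by blast
  have "0 < (INF (x0, \<theta>)\<in>Xl \<times> \<Theta>lk. ereal (Max ((\<lambda>j. \<bar>b j x0 \<theta>\<bar>) ` {..<J})))"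
    using exp unfolding expansion_bound_def by blast
  then obtain \<delta> where \<delta>: "0 < ereal \<delta>"
    "ereal \<delta> < (INF (x0, \<theta>)\<in>Xl \<times> \<Theta>lk. ereal (Max ((\<lambda>j. \<bar>b j x0 \<theta>\<bar>) ` {..<J})))"
    using ereal_dense2[of 0] by (auto simp: zero_ereal_def)
  have large_coeff: "\<exists>m<J. \<delta> < \<bar>b m x0 \<theta>\<bar>" if "x0 \<in> Xl" "\<theta> \<in> \<Theta>lk" for x0 \<theta>
  proof -
    have "(INF (x0, \<theta>)\<in>Xl \<times> \<Theta>lk. ereal (Max ((\<lambda>j. \<bar>b j x0 \<theta>\<bar>) ` {..<J})))
        \<le> ereal (Max ((\<lambda>j. \<bar>b j x0 \<theta>\<bar>) ` {..<J}))"
      by (rule INF_lower2[of "(x0, \<theta>)"]) (use that in simp_all)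
    with \<delta>(2) have "ereal \<delta> < ereal (Max ((\<lambda>j. \<bar>b j x0 \<theta>\<bar>) ` {..<J}))"
      by (rule less_le_trans)
    moreover have "Max ((\<lambda>j. \<bar>b j x0 \<theta>\<bar>) ` {..<J}) \<in> (\<lambda>j. \<bar>b j x0 \<theta>\<bar>) ` {..<J}"
      using J by (intro Max_in) (auto simp: lessThan_empty_iff)
    ultimately show ?thesis by auto
  qed
  define B' where "B' = max B 0"
  \<comment> \<open>Any \<open>\<kappa>\<close> above all \<open>\<alpha> j * (J - 1)\<close> works: then \<open>n\<^sup>-\<^sup>\<kappa>\<close> divided by \<open>\<bar>u j\<bar>\<^bsup>J - 1\<^esup>\<close> still tends to \<open>0\<close>.\<close>
  define \<kappa> where "\<kappa> = 1 + (\<Sum>j<J. \<alpha> j) * real J"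
  have sum\<alpha>: "\<alpha> j \<le> (\<Sum>j<J. \<alpha> j)" if "j < J" for j
    using member_le_sum[of j "{..<J}" \<alpha>] that pos by (auto intro: less_imp_le)
  have sum\<alpha>0: "0 \<le> (\<Sum>j<J. \<alpha> j)" using pos by (intro sum_nonneg) (auto intro: less_imp_le)
  have \<kappa>: "\<alpha> j * real (J - 1) < \<kappa>" if "j < J" for j
  proof -
    have "\<alpha> j * real (J - 1) \<le> (\<Sum>j<J. \<alpha> j) * real J"
      using sum\<alpha>[OF that] sum\<alpha>0 by (intro mult_mono) auto
    then show ?thesis by (simp add: \<kappa>_def)
  qed
  have \<kappa>0: "0 < \<kappa>" unfolding \<kappa>_def using sum\<alpha>0 by (intro add_pos_nonneg mult_nonneg_nonneg) auto
  \<comment> \<open>Two error terms at each of the \<open>J\<close> points then add up to \<open>\<delta> / 2\<close>.\<close>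
  define \<delta>' where "\<delta>' = \<delta> / (4 * real J)"
  have \<delta>'0: "0 < \<delta>'" using \<delta> J by (simp add: \<delta>'_def)
  have "\<forall>\<^sub>F n in sequentially. \<forall>j\<in>{..<J}. 4 ^ (J - 1) * real n powr - (\<kappa> - \<alpha> j * real (J - 1)) \<le> \<delta>'"
    using \<delta>'0 \<kappa> by (intro eventually_ball_finite ballI eventually_mult_powr_le_const) auto
  moreover have "\<forall>\<^sub>F n in sequentially. \<forall>j\<in>{..<J}. (4 ^ (J - 1) * B') * real n powr (- \<alpha> j) \<le> \<delta>'"
    using \<delta>'0 pos by (intro eventually_ball_finite ballI eventually_mult_powr_le_const) auto
  ultimately have "\<forall>\<^sub>F n in sequentially. \<forall>x0\<in>Xl. \<forall>\<theta>\<in>\<Theta>lk. \<forall>x.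
           (\<forall>j<J. x j - x0 \<in> dsector e \<epsilon> \<and> \<bar>e \<bullet> (x j - x0)\<bar> = real n powr (- \<alpha> j)) \<longrightarrow>
           (\<exists>j<J. real n powr (- \<kappa>) \<le> \<bar>f (x j) \<theta>\<bar>)"
    using separated_of_distinct_scales[OF inj] eventually_gt_at_top[of 0]
  proof eventually_elim
    case (elim n)
    show ?case
    proof (intro ballI allI impI, rule ccontr)
      fix x0 \<theta> and x :: "nat \<Rightarrow> real^'d"
      assume x0: "x0 \<in> Xl" and \<theta>: "\<theta> \<in> \<Theta>lk"
        and x: "\<forall>j<J. x j - x0 \<in> dsector e \<epsilon> \<and> \<bar>e \<bullet> (x j - x0)\<bar> = real n powr (- \<alpha> j)"
        and neg: "\<not> (\<exists>j<J. real n powr (- \<kappa>) \<le> \<bar>f (x j) \<theta>\<bar>)"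
      have small: "\<bar>f (x j) \<theta>\<bar> \<le> real n powr (- \<kappa>)" if "j < J" for j
        using neg that by (meson linear)
      define u where "u j = e \<bullet> (x j - x0)" for j
      have u: "\<bar>u j\<bar> = real n powr (- \<alpha> j)" if "j < J" for j using x that by (simp add: u_def)
      have u1: "u j \<noteq> 0 \<and> \<bar>u j\<bar> \<le> 1" if "j < J" for j
      proof
        show "u j \<noteq> 0" using u[OF that] elim(4) by auto
        show "\<bar>u j\<bar> \<le> 1" 
          using u[OF that] pos[OF that] elim(4) powr_mono[of "- \<alpha> j" 0 "real n"] by simp
      qed
      have sep: "\<bar>u j\<bar> / 2 \<le> \<bar>u j - u i\<bar>" if "i < J" "j < J" "i \<noteq> j" for i j
        using elim(3)[rule_format, OF that u[OF that(1)] u[OF that(2)]] .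
      have val: "\<bar>\<Sum>i<J. b i x0 \<theta> * u j ^ i\<bar> \<le> real n powr (- \<kappa>) + B' * \<bar>u j\<bar> ^ J" if j: "j < J" for j
      proof -
        let ?v = "(1 / norm (x j - x0)) *\<^sub>R (x j - x0)"
        have ne: "x j - x0 \<noteq> 0" using u1[OF j] by (auto simp: u_def)
        have mem: "x j \<in> dsector_at x0 e \<epsilon>"
          unfolding dsector_at_def using x j by (intro image_eqI[of _ _ "x j - x0"]) auto
        have "\<bar>bJ x0 (x j) \<theta> ?v\<bar> \<le> B'"
          using B[OF x0 mem \<theta>, of ?v] ne by (simp add: B'_def)
        then have "\<bar>bJ x0 (x j) \<theta> ?v * u j ^ J\<bar> \<le> B' * \<bar>u j\<bar> ^ J"
          by (simp add: abs_mult power_abs mult_right_mono)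
        moreover have "\<bar>(\<Sum>i<J. b i x0 \<theta> * u j ^ i) + bJ x0 (x j) \<theta> ?v * u j ^ J\<bar> \<le> real n powr (- \<kappa>)"
          using order_trans[OF fG[OF x0 mem \<theta>] small[OF j]] ne by (simp add: G_expansion_def u_def)
        ultimately show ?thesis by linarith
      qed
      obtain m where m: "m < J" "\<delta> < \<bar>b m x0 \<theta>\<bar>" using large_coeff[OF x0 \<theta>] by blast
      have "\<bar>b m x0 \<theta>\<bar> \<le> (\<Sum>j<J. 4 ^ (J - 1) * ((real n powr (- \<kappa>) + B' * \<bar>u j\<bar> ^ J) / \<bar>u j\<bar> ^ (J - 1)))"
        by (rule coeff_le_values_at_separated_points[OF u1 sep val m(1)])
      also have "\<dots> \<le> (\<Sum>j<J. 2 * \<delta>')"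
      proof (rule sum_mono)
        fix j assume "j \<in> {..<J}"
        then have j: "j < J" by simp
        have upos: "\<bar>u j\<bar> ^ (J - 1) > 0" using u1[OF j] by simp
        have "\<bar>u j\<bar> ^ (J - 1) = real n powr (- (\<alpha> j * real (J - 1)))"
          using elim(4) by (simp add: u[OF j] powr_power mult.commute)
        then have 1: "real n powr (- \<kappa>) / \<bar>u j\<bar> ^ (J - 1) = real n powr - (\<kappa> - \<alpha> j * real (J - 1))"
          by (simp add: powr_diff[symmetric])
        have "\<bar>u j\<bar> ^ J = \<bar>u j\<bar> * \<bar>u j\<bar> ^ (J - 1)" using J by (simp add: power_eq_if)
        then have 2: "B' * \<bar>u j\<bar> ^ J / \<bar>u j\<bar> ^ (J - 1) = B' * real n powr (- \<alpha> j)"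
          using upos u[OF j] by simp
        have "4 ^ (J - 1) * ((real n powr (- \<kappa>) + B' * \<bar>u j\<bar> ^ J) / \<bar>u j\<bar> ^ (J - 1))
          = 4 ^ (J - 1) * (real n powr (- \<kappa>) / \<bar>u j\<bar> ^ (J - 1) + B' * \<bar>u j\<bar> ^ J / \<bar>u j\<bar> ^ (J - 1))"
          by (rule arg_cong[OF add_divide_distrib])
        also have "\<dots> = 4 ^ (J - 1) * (real n powr - (\<kappa> - \<alpha> j * real (J - 1)) + B' * real n powr (- \<alpha> j))"
          unfolding 1 2 ..
        also have "\<dots> = 4 ^ (J - 1) * real n powr - (\<kappa> - \<alpha> j * real (J - 1)) + (4 ^ (J - 1) * B') * real n powr (- \<alpha> j)"
          by (simp add: distrib_left)
        also have "\<dots> \<le> \<delta>' + \<delta>'" using elim(1,2) j by (intro add_mono) auto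
        finally show "4 ^ (J - 1) * ((real n powr (- \<kappa>) + B' * \<bar>u j\<bar> ^ J) / \<bar>u j\<bar> ^ (J - 1)) \<le> 2 * \<delta>'"
          by simp
      qed
      also have "\<dots> = \<delta> / 2" using J by (simp add: \<delta>'_def)
      finally show False using m \<delta> by simp
    qed
  qed
  then show ?thesis using \<kappa>0 by blast
qed


section \<open>Rapidly decreasing sequences and polynomial tails\<close>

lemma rapidly_decreasing_bound:
  assumes "rapidly_decreasing a" "0 < L"
  obtains C where "0 < C" "\<And>n. n \<ge> 1 \<Longrightarrow> a n \<le> C * real n powr (- L)"
proof -
  obtain C where C: "\<And>n. n \<ge> 1 \<Longrightarrow> a n \<le> C / real n powr L"
    using assms unfolding rapidly_decreasing_def by blast
  have "a n \<le> max C 1 * real n powr (- L)" if "n \<ge> 1" for n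
  proof -
    have "C / real n powr L \<le> max C 1 / real n powr L" by (intro divide_right_mono) auto
    then show ?thesis using C[OF that] by (simp add: powr_minus divide_inverse)
  qed
  then show thesis using that[of "max C 1"] by simp
qed

lemma rapidly_decreasing_add:
  assumes "rapidly_decreasing a" "rapidly_decreasing b"
  shows "rapidly_decreasing (\<lambda>n. a n + b n)"
  unfolding rapidly_decreasing_def
proof (intro conjI allI impI)
  fix n :: nat assume "1 \<le> n"
  then show "0 \<le> a n + b n" using assms by (simp add: rapidly_decreasing_def)
next
  fix L :: real assume L: "0 < L"
  obtain C D where "\<forall>n\<ge>1. a n \<le> C / real n powr L" "\<forall>n\<ge>1. b n \<le> D / real n powr L"
    using assms L unfolding rapidly_decreasing_def by blast
  then show "\<exists>E. \<forall>n\<ge>1. a n + b n \<le> E / real n powr L"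
    by (intro exI[of _ "C + D"]) (auto simp: add_divide_distrib intro: add_mono)
qed

lemma rapidly_decreasing_power:
  assumes a: "rapidly_decreasing a" and N: "1 \<le> N"
  shows "rapidly_decreasing (\<lambda>n. a (n ^ N))"
  unfolding rapidly_decreasing_def
proof (intro conjI allI impI)
  fix n :: nat assume "1 \<le> n"
  then show "0 \<le> a (n ^ N)" using a by (simp add: rapidly_decreasing_def)
next
  fix L :: real assume L: "0 < L"
  obtain C where C: "\<forall>n\<ge>1. a n \<le> C / real n powr (L / real N)"
    using a L N unfolding rapidly_decreasing_def by (meson divide_pos_pos of_nat_0_less_iff less_le_trans zero_less_one)
  have "a (n ^ N) \<le> C / real n powr L" if "n \<ge> 1" for n
    using C[rule_format, of "n ^ N"] that N by (simp add: powr_realpow[symmetric] powr_powr)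
  then show "\<exists>E. \<forall>n\<ge>1. a (n ^ N) \<le> E / real n powr L" by blast
qed

text \<open>Between \<open>n\<^sup>\<gamma>\<close> and \<open>(n + 1)\<^sup>\<gamma>\<close> the argument changes by a bounded factor only, so by monotonicity a bound
  along the sequence \<open>n\<^sup>\<gamma>\<close> controls \<open>p\<close> at all large arguments; at the others the trivial bound \<open>1\<close> is
  absorbed by the constant.\<close>

lemma polynomial_tail_of_rapidly_decreasing:
  fixes p :: "real \<Rightarrow> real"
  assumes anti: "\<And>x y. 0 < x \<Longrightarrow> x \<le> y \<Longrightarrow> p y \<le> p x"
    and le1: "\<And>x. p x \<le> 1"
    and \<gamma>: "0 < \<gamma>"
    and a: "rapidly_decreasing a"
    and ev: "\<forall>\<^sub>F n in sequentially. p (real n powr \<gamma>) \<le> a n"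
    and L: "0 < L"
  shows "\<exists>c>0. \<forall>x>0. p x \<le> c * x powr (- L)"
proof -
  obtain C where C: "0 < C" "\<And>n. n \<ge> 1 \<Longrightarrow> a n \<le> C * real n powr (- (L * \<gamma>))"
    using rapidly_decreasing_bound[OF a, of "L * \<gamma>"] L \<gamma> by auto
  obtain n0 where n0: "\<And>n. n \<ge> n0 \<Longrightarrow> p (real n powr \<gamma>) \<le> a n"
    using ev unfolding eventually_sequentially by blast
  define y where "y = real (max n0 1)"
  have y1: "1 \<le> y" by (simp add: y_def)
  let ?c = "C * 2 powr (L * \<gamma>) + y powr (\<gamma> * L)"
  have "p x \<le> ?c * x powr (- L)" if x: "0 < x" for x
  proof (cases "x powr (1 / \<gamma>) < y")
    case True
    then have "(x powr (1 / \<gamma>)) powr (\<gamma> * L) \<le> y powr (\<gamma> * L)"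
      using \<gamma> L by (intro powr_mono2) auto
    then have "x powr L \<le> y powr (\<gamma> * L)" using \<gamma> by (simp add: powr_powr)
    then have "1 \<le> y powr (\<gamma> * L) * x powr (- L)" using x by (simp add: powr_minus field_simps)
    also have "\<dots> \<le> ?c * x powr (- L)" using C by (intro mult_right_mono) auto
    finally show ?thesis using le1[of x] by linarith
  next
    case False
    \<comment> \<open>Compare \<open>x = z\<^sup>\<gamma>\<close> with \<open>n\<^sup>\<gamma>\<close> for \<open>n = \<lfloor>z\<rfloor>\<close>; since \<open>z \<ge> 1\<close>, one has \<open>z / 2 \<le> n \<le> z\<close>.\<close>
    define z where "z = x powr (1 / \<gamma>)"
    have zx: "z powr \<gamma> = x" using x \<gamma> by (simp add: z_def powr_powr)
    have zy: "y \<le> z" using False by (simp add: z_def)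
    define n where "n = nat \<lfloor>z\<rfloor>"
    have n: "real n \<le> z" "z / 2 \<le> real n" "max n0 1 \<le> n"
    proof -
      show "real n \<le> z" unfolding n_def using zy y1 by (simp add: of_nat_floor)
      have "z < real n + 1" unfolding n_def using zy y1 by linarith
      then show "max n0 1 \<le> n" using zy unfolding y_def by linarith
      then have "1 \<le> n" by simp
      then show "z / 2 \<le> real n" using \<open>z < real n + 1\<close> by linarith
    qed
    have "p x \<le> p (real n powr \<gamma>)"
    proof (rule anti)
      show "0 < real n powr \<gamma>" using n by simp
      have "real n powr \<gamma> \<le> z powr \<gamma>" using n \<gamma> by (intro powr_mono2) auto
      then show "real n powr \<gamma> \<le> x" using zx by simp
    qed
    also have "\<dots> \<le> a n" using n by (intro n0) simp
    also have "\<dots> \<le> C * real n powr (- (L * \<gamma>))" using n by (intro C) simp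
    also have "\<dots> \<le> C * (z / 2) powr (- (L * \<gamma>))"
      using C(1) n zy y1 L \<gamma> by (intro mult_left_mono powr_mono2') auto
    also have "\<dots> = C * 2 powr (L * \<gamma>) * (z powr \<gamma>) powr (- L)"
      using zy y1 by (simp add: powr_divide powr_powr powr_minus field_simps)
    also have "\<dots> \<le> ?c * x powr (- L)" unfolding zx by (intro mult_right_mono) auto
    finally show ?thesis .
  qed
  moreover have "0 < ?c" using C y1 by (intro add_pos_nonneg) auto
  ultimately show ?thesis by blast
qed

section \<open>From a large value of \<open>f\<close> to a lower bound for \<open>chi0\<close>\<close>

text \<open>The bound \<open>\<epsilon> / 2\<close> on both the initial distance and the oscillation keeps the path inside the ball, hence in
  the domain \<open>U\<close> on which \<open>g\<close> is Lipschitz.\<close>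

lemma lower_bound_persists_near_start:
  fixes y :: "real \<Rightarrow> real^'d" and g :: "real^'d \<Rightarrow> real"
  assumes ball: "ball x0 \<epsilon> \<subseteq> U" and \<epsilon>: "0 < \<epsilon>"
    and lip: "K-lipschitz_on U g"
    and start: "norm (y r - x0) \<le> \<epsilon> / 2"
    and osc: "norm (y t - y r) < d" and d: "d \<le> \<epsilon> / 2" "K * d \<le> c"
    and big: "2 * c \<le> \<bar>g (y r)\<bar>"
  shows "y t \<in> U \<and> c \<le> \<bar>g (y t)\<bar>"
proof -
  have "norm (y t - x0) \<le> norm (y t - y r) + norm (y r - x0)"
    using norm_triangle_ineq[of "y t - y r" "y r - x0"] by simp
  then have yt: "y t \<in> U" using ball start osc d by (auto simp: dist_norm norm_minus_commute)
  have yr: "y r \<in> U" using ball start \<epsilon> by (auto simp: dist_norm norm_minus_commute)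
  have "\<bar>g (y t) - g (y r)\<bar> \<le> K * norm (y t - y r)"
    using lipschitz_onD[OF lip yt yr] by (simp add: dist_norm)
  also have "\<dots> \<le> K * d"
    using osc lipschitz_on_nonneg[OF lip] by (intro mult_left_mono) auto
  finally show ?thesis using yt big d by auto
qed

text \<open>For each \<open>\<theta>\<close> separately, the integrand divided by \<open>\<bar>\<theta> - \<theta>s\<bar>\<^sup>2\<close> is at least \<open>c powr \<rho>R\<close> on an interval of length \<open>h\<close>.
  The interval may depend on \<open>\<theta>\<close>; only its length and the level \<open>c\<close> must be uniform.\<close>

lemma chi0_ge:
  fixes X :: "real \<Rightarrow> 'w \<Rightarrow> real^'d" and \<Theta> :: "(real^'p) set"
  assumes Q0: "\<And>x \<theta>. \<theta> \<in> \<Theta> \<Longrightarrow> Q x \<theta> \<ge> 0"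
    and R: "condition_R \<Theta> \<theta>s Xhat Q f \<rho>R"
    and c: "0 \<le> c" and h: "0 < h"
    and big: "\<And>\<theta>. \<theta> \<in> \<Theta> \<Longrightarrow> \<theta> \<noteq> \<theta>s \<Longrightarrow>
      \<exists>r\<ge>0. r + h \<le> T \<and> (\<forall>t\<in>{r..r + h}. X t \<omega> \<in> Xhat \<and> c \<le> \<bar>f (X t \<omega>) \<theta>\<bar>)"
  shows "ennreal (h * c powr \<rho>R) \<le> chi0 T X Q \<Theta> \<theta>s \<omega>"
  unfolding chi0_def
proof (rule INF_greatest)
  fix \<theta> assume "\<theta> \<in> \<Theta> - {\<theta>s}"
  then have \<theta>: "\<theta> \<in> \<Theta>" "\<theta> \<noteq> \<theta>s" by auto
  define w where "w = (norm (\<theta> - \<theta>s))\<^sup>2"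
  have w: "0 < w" using \<theta> by (simp add: w_def)
  obtain r where r: "0 \<le> r" "r + h \<le> T"
      "\<And>t. t \<in> {r..r + h} \<Longrightarrow> X t \<omega> \<in> Xhat \<and> c \<le> \<bar>f (X t \<omega>) \<theta>\<bar>"
    using big[OF \<theta>] by blast
  have Qge: "c powr \<rho>R * w \<le> Q (X t \<omega>) \<theta>" if "t \<in> {r..r + h}" for t
  proof -
    have "c powr \<rho>R \<le> \<bar>f (X t \<omega>) \<theta>\<bar> powr \<rho>R"
      using r(3)[OF that] c R by (intro powr_mono2) (auto simp: condition_R_def)
    also have "\<dots> \<le> Q (X t \<omega>) \<theta> / w"
      using R \<theta> r(3)[OF that] unfolding condition_R_def w_def by blast
    finally show ?thesis using w by (simp add: field_simps)
  qed
  have "ennreal (h * c powr \<rho>R) * ennreal w = ennreal (c powr \<rho>R * w) * ennreal h"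
    using w h by (simp add: ennreal_mult[symmetric] ac_simps)
  also have "\<dots> = (\<integral>\<^sup>+t. ennreal (c powr \<rho>R * w) * indicator {r..r + h} t \<partial>lebesgue)"
    using h by (subst nn_integral_cmult_indicator) auto
  also have "\<dots> \<le> (\<integral>\<^sup>+t\<in>{0..T}. ennreal (Q (X t \<omega>) \<theta>) \<partial>lebesgue)"
    using r(1,2) Qge by (intro nn_integral_mono) (auto simp: indicator_def intro!: ennreal_leI)
  finally show "ennreal (h * c powr \<rho>R)
      \<le> (\<integral>\<^sup>+t\<in>{0..T}. ennreal (Q (X t \<omega>) \<theta>) \<partial>lebesgue) / ennreal ((norm (\<theta> - \<theta>s))\<^sup>2)"
    unfolding w_def[symmetric] using w
    by (subst ennreal_mult_divide_eq[symmetric, of "ennreal w"]) (auto intro: divide_right_mono_ennreal)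
qed

lemma increment_less_if_no_oscillation:
  assumes "\<omega> \<in> space M" "\<omega> \<notin> oscillation_event M T X Xhat \<beta>0 m"
    and "0 \<le> r" "X r \<omega> \<in> Xhat" "t \<in> {r..r + 1 / real m}" "t \<le> T"
  shows "norm (X t \<omega> - X r \<omega>) < real m powr (- \<beta>0)"
proof -
  have "ennreal (norm (X t \<omega> - X r \<omega>)) \<le> (SUP (s, t)\<in>{(s, t). s \<in> {0..T} \<and> t \<in> {0..T} \<and> X s \<omega> \<in> Xhat \<and> t \<in> {s..s + 1 / real m}}.
           ennreal (norm (X t \<omega> - X s \<omega>)))"
    using assms by (intro SUP_upper2[of "(r, t)"]) auto
  also have "\<dots> < ennreal (real m powr (- \<beta>0))"
    using assms by (auto simp: oscillation_event_def not_le)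
  finally show ?thesis by (simp add: ennreal_less_iff)
qed

section \<open>The tail of \<open>chi0\<close>\<close>

theorem proposition1:
  fixes M :: "'w measure"
    and T :: real
    and X :: "real \<Rightarrow> 'w \<Rightarrow> real^'d"
    and \<Theta> :: "(real^'p) set" and \<theta>s :: "real^'p"
    and X0 Xhat :: "(real^'d) set"
    and Q f :: "real^'d \<Rightarrow> real^'p \<Rightarrow> real"
    and J :: nat and \<rho>R :: real
  assumes "prob_space M"
    and "T > 0"
    and "separable_process M T X"
    and "\<theta>s \<in> \<Theta>"
    and "X0 \<subseteq> interior Xhat"
    and "\<And>x \<theta>. \<theta> \<in> \<Theta> \<Longrightarrow> Q x \<theta> \<ge> 0"
    and "J \<ge> 1"
    and path_measurable: "\<And>\<theta> \<omega>. \<theta> \<in> \<Theta> \<Longrightarrow> \<omega> \<in> space M \<Longrightarrow>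
           (\<lambda>t. Q (X t \<omega>) \<theta>) \<in> borel_measurable (lebesgue_on {0..T})"
    and chi0_measurable: "chi0 T X Q \<Theta> \<theta>s \<in> borel_measurable M"
    and N0: "condition_N0 M T X \<Theta> X0 Xhat f J"
    and R: "condition_R \<Theta> \<theta>s Xhat Q f \<rho>R"
    and C: "condition_C M T X Xhat"
  shows "\<forall>L>0. \<exists>c>0. \<forall>\<rho>>0.
           measure M {\<omega> \<in> space M. chi0 T X Q \<Theta> \<theta>s \<omega> \<le> ennreal (1 / \<rho>)} \<le> c * \<rho> powr (- L)"
proof (intro allI impI)
  fix L :: real assume L: "0 < L"
  interpret prob_space M by fact
  obtain T0 lbar \<X> kbar \<xi> \<epsilon> \<Theta>s b bJ c0 \<alpha> where
      T0: "0 < T0" "T0 < T"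
    and par: "\<forall>l\<in>{1..lbar}. \<forall>k\<in>{1..kbar l}.
              norm (\<xi> l k) = 1 \<and> 0 < \<epsilon> l k \<and> \<epsilon> l k < 1 \<and> \<Theta>s l k \<subseteq> \<Theta>"
    and cover: "\<forall>l\<in>{1..lbar}. \<Theta> = (\<Union>k\<in>{1..kbar l}. \<Theta>s l k)"
    and expand: "\<forall>l\<in>{1..lbar}. \<forall>k\<in>{1..kbar l}.
              expansion_bound f J (\<X> l) (\<xi> l k) (\<epsilon> l k) (\<Theta>s l k) (b l k) (bJ l k)"
    and balls: "(\<Union>l\<in>{1..lbar}. \<Union>k\<in>{1..kbar l}. \<Union>x0\<in>\<X> l. closure (ball x0 (\<epsilon> l k))) \<subseteq> Xhat"
    and c0: "c0 > 0"
    and \<alpha>: "\<forall>l\<in>{1..lbar}. \<forall>k\<in>{1..kbar l}.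
                 inj_on (\<alpha> l k) {0..J} \<and> (\<forall>j\<in>{0..J}. \<alpha> l k j > 0)"
    and hit_meas: "\<forall>n\<ge>1. hitting_event M T X J T0 lbar kbar \<X> \<xi> \<epsilon> c0 \<alpha> n \<in> sets M"
    and hit: "rapidly_decreasing
                (\<lambda>n. 1 - measure M (hitting_event M T X J T0 lbar kbar \<X> \<xi> \<epsilon> c0 \<alpha> n))"
    using N0 unfolding condition_N0_def by (elim exE conjE) (rule that)
  obtain \<beta>0 where \<beta>0: "\<beta>0 > 0"
    and osc_meas: "\<forall>n\<ge>1. oscillation_event M T X Xhat \<beta>0 n \<in> sets M"
    and osc: "rapidly_decreasing (\<lambda>n. measure M (oscillation_event M T X Xhat \<beta>0 n))"
    using C unfolding condition_C_def by (elim exE conjE) (rule that)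
  obtain K where lip: "\<And>\<theta>. \<theta> \<in> \<Theta> \<Longrightarrow> K-lipschitz_on Xhat (\<lambda>x. f x \<theta>)"
    using R unfolding condition_R_def by blast
  have \<rho>R: "0 < \<rho>R" using R unfolding condition_R_def by blast
  define I where "I = Sigma {1..lbar} (\<lambda>l. {1..kbar l})"
  have finI: "finite I" by (simp add: I_def)
  let ?A = "hitting_event M T X J T0 lbar kbar \<X> \<xi> \<epsilon> c0 \<alpha>"
  let ?B = "oscillation_event M T X Xhat \<beta>0"
  let ?P = "\<lambda>i n y. \<forall>x0\<in>\<X> (fst i). \<forall>\<theta>\<in>\<Theta>s (fst i) (snd i). \<forall>x.
      (\<forall>j<J. x j - x0 \<in> dsector (\<xi> (fst i) (snd i)) (\<epsilon> (fst i) (snd i)) \<and>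
          \<bar>\<xi> (fst i) (snd i) \<bullet> (x j - x0)\<bar> = real n powr (- \<alpha> (fst i) (snd i) j)) \<longrightarrow>
      (\<exists>j<J. y \<le> \<bar>f (x j) \<theta>\<bar>)"
  have "\<exists>\<kappa>>0. \<forall>\<^sub>F n in sequentially. \<forall>i\<in>I. ?P i n (real n powr (- \<kappa>))"
  proof (rule common_exponent[OF finI])
    fix i assume "i \<in> I"
    then have i: "fst i \<in> {1..lbar}" "snd i \<in> {1..kbar (fst i)}" by (auto simp: I_def)
    have inj: "inj_on (\<alpha> (fst i) (snd i)) {..<J}"
      by (rule inj_on_subset[of _ "{0..J}"]) (use bspec[OF bspec[OF \<alpha> i(1)] i(2)] in auto)
    show "\<exists>\<kappa>>0. \<forall>\<^sub>F n in sequentially. ?P i n (real n powr (- \<kappa>))"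
      by (rule expansion_bound_lower[OF expand[rule_format, OF i] \<open>J \<ge> 1\<close> inj]) (use \<alpha> i in auto)
  next
    fix i n x y
    assume P: "?P i n x" and yx: "y \<le> (x::real)"
    show "?P i n y"
    proof (intro ballI allI impI)
      fix x0 \<theta> z assume "x0 \<in> \<X> (fst i)" "\<theta> \<in> \<Theta>s (fst i) (snd i)"
        "\<forall>j<J. z j - x0 \<in> dsector (\<xi> (fst i) (snd i)) (\<epsilon> (fst i) (snd i)) \<and>
          \<bar>\<xi> (fst i) (snd i) \<bullet> (z j - x0)\<bar> = real n powr (- \<alpha> (fst i) (snd i) j)"
      with P obtain j where "j < J" "x \<le> \<bar>f (z j) \<theta>\<bar>" by blast
      then show "\<exists>j<J. y \<le> \<bar>f (z j) \<theta>\<bar>" using yx by (intro exI[of _ j]) auto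
    qed
  qed
  then obtain \<kappa> where \<kappa>: "\<kappa> > 0" "\<forall>\<^sub>F n in sequentially. \<forall>i\<in>I. ?P i n (real n powr (- \<kappa>))"
    by blast
  \<comment> \<open>On the time scale \<open>n\<^sup>-\<^sup>N\<close> the oscillation is below \<open>n\<close> to the power \<open>-N \<beta>0\<close>, which has to be negligible
     against the lower bound \<open>n\<^sup>-\<^sup>\<kappa>\<close> for \<open>f\<close>.  The level \<open>\<kappa> + 1\<close> leaves room for a factor \<open>2\<close>.\<close>
  obtain N :: nat where "(\<kappa> + 1) / \<beta>0 + 1 < real N" using reals_Archimedean2 by blast
  moreover have "0 < (\<kappa> + 1) / \<beta>0" using \<kappa> \<beta>0 by simp
  ultimately have N: "1 \<le> N" "(\<kappa> + 1) / \<beta>0 < real N" by linarith+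
  have N\<beta>: "\<kappa> + 1 < N * \<beta>0" using N \<beta>0 by (simp add: field_simps)
  \<comment> \<open>\<open>chi0\<close> will be at least \<open>n\<^sup>-\<^sup>N\<close> (length of the interval) times the power \<open>\<rho>R\<close> of the level of \<open>f\<close>; the
     summand \<open>1\<close> makes the inequality strict.\<close>
  define \<gamma> where "\<gamma> = N + (\<kappa> + 1) * \<rho>R + 1"
  have \<gamma>: "0 < \<gamma>" unfolding \<gamma>_def using \<kappa> \<rho>R by (intro add_nonneg_pos) auto
  let ?p = "\<lambda>\<rho>. measure M {\<omega> \<in> space M. chi0 T X Q \<Theta> \<theta>s \<omega> \<le> ennreal (1 / \<rho>)}"
  have chi_meas: "{\<omega> \<in> space M. chi0 T X Q \<Theta> \<theta>s \<omega> \<le> y} \<in> sets M" for y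
    using chi0_measurable by measurable
  have "\<forall>\<^sub>F n in sequentially. \<forall>i\<in>I. \<forall>j\<in>{..<J}.
      1 * real n powr (- \<alpha> (fst i) (snd i) j) \<le> (1 - \<epsilon> (fst i) (snd i)) * (\<epsilon> (fst i) (snd i) / 2)"
    using finI par \<alpha> by (intro eventually_ball_finite ballI eventually_mult_powr_le_const) (auto simp: I_def)
  moreover have "\<forall>\<^sub>F n in sequentially. \<forall>i\<in>I. 1 * real n powr (- (N * \<beta>0)) \<le> \<epsilon> (fst i) (snd i) / 2"
    using finI par N \<beta>0 by (intro eventually_ball_finite ballI eventually_mult_powr_le_const) (auto simp: I_def)
  moreover have "\<forall>\<^sub>F n in sequentially. 1 * real n powr (- c0) \<le> (T - T0) / 2"
    using c0 T0 by (intro eventually_mult_powr_le_const) auto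
  moreover have "\<forall>\<^sub>F n in sequentially. 1 * real n powr (- real N) \<le> (T - T0) / 2"
    using N T0 by (intro eventually_mult_powr_le_const) auto
  moreover have "\<forall>\<^sub>F n in sequentially. K * real n powr (- (N * \<beta>0)) \<le> real n powr (- (\<kappa> + 1))"
    by (rule eventually_mult_powr_le[OF N\<beta>])
  moreover have "\<forall>\<^sub>F n in sequentially. 2 * real n powr (- (\<kappa> + 1)) \<le> real n powr (- \<kappa>)"
    by (rule eventually_mult_powr_le) simp
  ultimately have "\<forall>\<^sub>F n in sequentially. ?p (real n powr \<gamma>) \<le> (1 - measure M (?A n)) + measure M (?B (n ^ N))"
    using \<kappa>(2) eventually_ge_at_top[of 2]
  proof eventually_elim
    case (elim n)
    have n2: "2 \<le> n" by fact
    have mN: "real (n ^ N) = real n powr real N" using n2 by (simp add: powr_realpow)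
    have m\<beta>: "real (n ^ N) powr (- \<beta>0) = real n powr (- (N * \<beta>0))" unfolding mN by (simp add: powr_powr)
    have m1: "1 / real (n ^ N) = real n powr (- real N)" unfolding mN by (simp add: powr_minus divide_inverse)
    have sets: "?A n \<in> sets M" "?B (n ^ N) \<in> sets M" using hit_meas osc_meas n2 by auto
    \<comment> \<open>Off the two exceptional events the lower bound holds pathwise.\<close>
    have chi_large: "ennreal (1 / real n powr \<gamma>) < chi0 T X Q \<Theta> \<theta>s \<omega>"
      if \<omega>A: "\<omega> \<in> ?A n" and \<omega>B: "\<omega> \<notin> ?B (n ^ N)" for \<omega>
    proof -
      let ?h = "real n powr (- real N)" and ?c = "real n powr (- (\<kappa> + 1))"
      have \<omega>: "\<omega> \<in> space M" using \<omega>A by (simp add: hitting_event_def)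
      obtain l where l: "l \<in> {1..lbar}"
        and l_hit: "\<forall>k\<in>{1..kbar l}. \<exists>s\<in>{0..T0}. \<forall>j\<in>{0..J}. \<exists>t\<in>{0..real n powr (- c0)}.
          s + t \<le> T \<and> X s \<omega> \<in> \<X> l \<and> X (s + t) \<omega> - X s \<omega> \<in> dsector (\<xi> l k) (\<epsilon> l k) \<and>
          \<bar>\<xi> l k \<bullet> (X (s + t) \<omega> - X s \<omega>)\<bar> = real n powr (- \<alpha> l k j)"
        using \<omega>A unfolding hitting_event_def by blast
      have "ennreal (?h * ?c powr \<rho>R) \<le> chi0 T X Q \<Theta> \<theta>s \<omega>"
      proof (rule chi0_ge[OF \<open>\<And>x \<theta>. \<theta> \<in> \<Theta> \<Longrightarrow> Q x \<theta> \<ge> 0\<close> R])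
        show "0 \<le> ?c" "0 < ?h" using n2 by auto
        fix \<theta> assume \<theta>: "\<theta> \<in> \<Theta>" "\<theta> \<noteq> \<theta>s"
        obtain k where k: "k \<in> {1..kbar l}" "\<theta> \<in> \<Theta>s l k" using cover l \<theta> by blast
        have lk: "(l, k) \<in> I" using l k by (simp add: I_def)
        have par_lk: "norm (\<xi> l k) = 1" "0 < \<epsilon> l k" "\<epsilon> l k < 1" using par l k by auto
        obtain s where s: "s \<in> {0..T0}" and s_hit: "\<forall>j\<in>{0..J}. \<exists>t\<in>{0..real n powr (- c0)}.
          s + t \<le> T \<and> X s \<omega> \<in> \<X> l \<and> X (s + t) \<omega> - X s \<omega> \<in> dsector (\<xi> l k) (\<epsilon> l k) \<and>
          \<bar>\<xi> l k \<bullet> (X (s + t) \<omega> - X s \<omega>)\<bar> = real n powr (- \<alpha> l k j)"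
          using l_hit k by blast
        have "\<forall>j\<in>{0..J}. \<exists>t. t \<in> {0..real n powr (- c0)} \<and> X s \<omega> \<in> \<X> l \<and>
            X (s + t) \<omega> - X s \<omega> \<in> dsector (\<xi> l k) (\<epsilon> l k) \<and>
            \<bar>\<xi> l k \<bullet> (X (s + t) \<omega> - X s \<omega>)\<bar> = real n powr (- \<alpha> l k j)"
          using s_hit by blast
        from bchoice[OF this] obtain \<tau> where \<tau>: "\<And>j. j \<in> {0..J} \<Longrightarrow> \<tau> j \<in> {0..real n powr (- c0)} \<and> X s \<omega> \<in> \<X> l \<and>
            X (s + \<tau> j) \<omega> - X s \<omega> \<in> dsector (\<xi> l k) (\<epsilon> l k) \<and>
            \<bar>\<xi> l k \<bullet> (X (s + \<tau> j) \<omega> - X s \<omega>)\<bar> = real n powr (- \<alpha> l k j)"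
          by blast
        have x0: "X s \<omega> \<in> \<X> l" using \<tau>[of 0] by simp
        have Plk: "?P (l, k) n (real n powr (- \<kappa>))" using elim(7) lk by (rule bspec)
        have "\<exists>j<J. real n powr (- \<kappa>) \<le> \<bar>f (X (s + \<tau> j) \<omega>) \<theta>\<bar>"
          by (rule Plk[unfolded fst_conv snd_conv, rule_format, OF x0 k(2)]) (use \<tau> in auto)
        then obtain j where j: "j < J" "real n powr (- \<kappa>) \<le> \<bar>f (X (s + \<tau> j) \<omega>) \<theta>\<bar>" by blast
        \<comment> \<open>\<open>r\<close> is the start of the interval; \<open>r + n\<^sup>-\<^sup>N \<le> T\<close> because \<open>s \<le> T0\<close>, while \<open>\<tau> j\<close> and
           \<open>n\<^sup>-\<^sup>N\<close> are at most \<open>(T - T0) / 2\<close>.\<close>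
        define r where "r = s + \<tau> j"
        have r0: "0 \<le> r" and rT: "r + ?h \<le> T"
          using s \<tau>[of j] j elim(3,4) by (auto simp: r_def)
        have near: "norm (X r \<omega> - X s \<omega>) \<le> \<epsilon> l k / 2"
        proof -
          have "(1 - \<epsilon> l k) * norm (X r \<omega> - X s \<omega>) \<le> real n powr (- \<alpha> l k j)"
            using norm_le_inner_of_dsector[of "X r \<omega> - X s \<omega>" "\<xi> l k" "\<epsilon> l k"] \<tau>[of j] j par_lk by (simp add: r_def)
          also have "\<dots> \<le> (1 - \<epsilon> l k) * (\<epsilon> l k / 2)" using bspec[OF elim(1) lk] j by simp
          finally show ?thesis using par_lk by (simp add: mult_le_cancel_left_pos)
        qed
        have ball: "ball (X s \<omega>) (\<epsilon> l k) \<subseteq> Xhat"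
          using balls l k x0 closure_subset[of "ball (X s \<omega>) (\<epsilon> l k)"] by blast
        have Xr: "X r \<omega> \<in> Xhat"
          using ball near par_lk by (auto simp: dist_norm norm_minus_commute)
        have "X t \<omega> \<in> Xhat \<and> ?c \<le> \<bar>f (X t \<omega>) \<theta>\<bar>" if t: "t \<in> {r..r + ?h}" for t
        proof (rule lower_bound_persists_near_start[where g = "\<lambda>x. f x \<theta>" and y = "\<lambda>t. X t \<omega>" and r = r,
              OF ball par_lk(2) lip[OF \<theta>(1)] near])
          show "norm (X t \<omega> - X r \<omega>) < real n powr (- (N * \<beta>0))"
            using increment_less_if_no_oscillation[OF \<omega> \<omega>B r0 Xr, of t] t rT unfolding m1 m\<beta> by simp
          show "real n powr (- (N * \<beta>0)) \<le> \<epsilon> l k / 2" using bspec[OF elim(2) lk] by simp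
          show "K * real n powr (- (N * \<beta>0)) \<le> ?c" by (rule elim(5))
          show "2 * ?c \<le> \<bar>f (X r \<omega>) \<theta>\<bar>" using elim(6) j unfolding r_def by linarith
        qed
        then show "\<exists>r\<ge>0. r + ?h \<le> T \<and> (\<forall>t\<in>{r..r + ?h}. X t \<omega> \<in> Xhat \<and> ?c \<le> \<bar>f (X t \<omega>) \<theta>\<bar>)"
          using r0 rT by blast
      qed
      moreover have "1 / real n powr \<gamma> < ?h * ?c powr \<rho>R"
      proof -
        have "?h * ?c powr \<rho>R = real n powr (- (N + (\<kappa> + 1) * \<rho>R))"
          by (simp add: powr_powr powr_add[symmetric] algebra_simps)
        moreover have "real n powr (- \<gamma>) < real n powr (- (N + (\<kappa> + 1) * \<rho>R))"
          using n2 by (intro powr_less_mono) (auto simp: \<gamma>_def)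
        ultimately show ?thesis by (simp add: powr_minus divide_inverse)
      qed
      ultimately show ?thesis
        by (meson ennreal_lessI le_less_trans less_le_trans not_le powr_ge_zero divide_nonneg_nonneg zero_le_one)
    qed
    have "?p (real n powr \<gamma>) \<le> measure M ((space M - ?A n) \<union> ?B (n ^ N))"
    proof (rule finite_measure_mono)
      show "{\<omega> \<in> space M. chi0 T X Q \<Theta> \<theta>s \<omega> \<le> ennreal (1 / real n powr \<gamma>)}
          \<subseteq> (space M - ?A n) \<union> ?B (n ^ N)"
        using chi_large by (auto simp: not_le[symmetric])
      show "(space M - ?A n) \<union> ?B (n ^ N) \<in> sets M" using sets by auto
    qed
    also have "\<dots> \<le> measure M (space M - ?A n) + measure M (?B (n ^ N))"
      using sets by (intro measure_Un_le) auto
    also have "measure M (space M - ?A n) = 1 - measure M (?A n)" using sets by (intro prob_compl) auto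
    finally show ?case .
  qed
  then show "\<exists>c>0. \<forall>\<rho>>0. ?p \<rho> \<le> c * \<rho> powr (- L)"
  proof (rule polynomial_tail_of_rapidly_decreasing[rotated 4])
    show "rapidly_decreasing (\<lambda>n. (1 - measure M (?A n)) + measure M (?B (n ^ N)))"
      by (rule rapidly_decreasing_add[OF hit rapidly_decreasing_power[OF osc N(1)]])
    fix x y :: real assume "0 < x" "x \<le> y"
    then have "ennreal (1 / y) \<le> ennreal (1 / x)" by (intro ennreal_leI divide_left_mono) auto
    then show "?p y \<le> ?p x"
      by (intro finite_measure_mono chi_meas) (auto intro: order_trans)
  qed (use \<gamma> L in auto)
qed

end
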